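(* Let $r>0$ be real. For $n\ge1$ let $\mathcal{B}_{n,r}(x)=\sum_{j=0}^nS_r(n+r,j+r)x^j$ be the $n$-th $r$-Bell polynomial, where the $r$-Stirling numbers of the second kind $S_r(n+r,j+r)$ are defined by $(x+r)^n=\sum_{j=0}^nS_r(n+r,j+r)\,x(x-1)\cdots(x-j+1)$. (Then $\mathcal{B}_{n,r}$ has $n$ simple negative zeros.) Let $\zeta_{m,r}(n)$, $1\le m\le n$, denote the zeros of $\mathcal{B}_{n,r}$ ordered in decreasing size. Then for every positive integer $m$, $$\lim_{n\to\infty}\frac{\zeta_{m,r}(n)}{-m\left(\frac{m+r-1}{m+r}\right)^n}=1.$$ *)

theory Defs
  imports Complex_Main "HOL-Computational_Algebra.Polynomial"
begin

definition rstirling_expansion :: "real \<Rightarrow> nat \<Rightarrow> (nat \<Rightarrow> real) \<Rightarrow> bool" where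
  "rstirling_expansion r n c \<longleftrightarrow>
     (\<forall>x::real. (x + r) ^ n = (\<Sum>j\<le>n. c j * (\<Prod>i<j. x - real i)))"

(* rstirling r n j is S_r(n+r, j+r).  The defining identity only constrains the
   coefficients with j \<le> n; the others are set to 0 so that the definite description
   is unique (see rstirling_ex1). *)
definition rstirling :: "real \<Rightarrow> nat \<Rightarrow> nat \<Rightarrow> real" where
  "rstirling r n = (THE c. rstirling_expansion r n c \<and> (\<forall>j>n. c j = 0))"

definition rbell :: "real \<Rightarrow> nat \<Rightarrow> real poly" where
  "rbell r n = (\<Sum>j\<le>n. monom (rstirling r n j) j)"

(* The m-th largest real zero, counted from m = 1; only meaningful when the polynomial
   has at least m distinct real zeros. *)
definition rbell_zero :: "real \<Rightarrow> nat \<Rightarrow> nat \<Rightarrow> real" where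
  "rbell_zero r m n = rev (sorted_list_of_set {x. poly (rbell r n) x = 0}) ! (m - 1)"

lemma rstirling_expansion_ex:
  "\<exists>c. rstirling_expansion r n c \<and> (\<forall>j>n. c j = 0)"
proof (induction n)
  case 0
  show ?case
    by (rule exI[of _ "\<lambda>j. if j = 0 then 1 else 0"]) (simp add: rstirling_expansion_def)
next
  case (Suc n)
  then obtain c where c: "rstirling_expansion r n c" and z: "\<And>j. j > n \<Longrightarrow> c j = 0"
    by blast
  define d where "d j = (if j = 0 then 0 else c (j - 1)) + (real j + r) * c j" for j
  have "(x + r) ^ Suc n = (\<Sum>j\<le>Suc n. d j * (\<Prod>i<j. x - real i))" for x
  proof -
    let ?F = "\<lambda>j. (\<Prod>i<j. x - real i)"
    have "(x + r) ^ Suc n = (\<Sum>j\<le>n. (x + r) * (c j * ?F j))"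
      using c by (simp add: rstirling_expansion_def sum_distrib_left)
    also have "\<dots> = (\<Sum>j\<le>n. c j * ?F (Suc j) + (real j + r) * c j * ?F j)"
      by (intro sum.cong refl) (simp add: algebra_simps)
    also have "\<dots> = (\<Sum>j\<le>n. c j * ?F (Suc j)) + (\<Sum>j\<le>n. (real j + r) * c j * ?F j)"
      by (rule sum.distrib)
    also have "(\<Sum>j\<le>n. c j * ?F (Suc j)) =
        (\<Sum>j\<le>Suc n. (if j = 0 then 0 else c (j - 1)) * ?F j)"
      by (subst sum.atMost_Suc_shift) simp
    also have "(\<Sum>j\<le>n. (real j + r) * c j * ?F j) = (\<Sum>j\<le>Suc n. (real j + r) * c j * ?F j)"
      using z by simp
    finally show ?thesis
      by (simp only: d_def distrib_right sum.distrib)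
  qed
  moreover have "\<forall>j>Suc n. d j = 0"
    using z by (simp add: d_def)
  ultimately show ?case
    unfolding rstirling_expansion_def by blast
qed

lemma rstirling_expansion_unique:
  assumes "rstirling_expansion r n c" "rstirling_expansion r n d" "k \<le> n"
  shows "c k = d k"
  using \<open>k \<le> n\<close>
proof (induction k rule: less_induct)
  case (less k)
  let ?F = "\<lambda>j. (\<Prod>i<j. real k - real i)"
  have eq: "(\<Sum>j\<le>n. (c j - d j) * ?F j) = 0"
    using assms(1,2) unfolding rstirling_expansion_def
    by (simp add: left_diff_distrib sum_subtractf)
  have "(\<Sum>j\<le>n. (c j - d j) * ?F j) = (\<Sum>j\<in>{k}. (c j - d j) * ?F j)"
  proof (rule sum.mono_neutral_right)
    show "\<forall>j\<in>{..n} - {k}. (c j - d j) * ?F j = 0"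
    proof
      fix j assume j: "j \<in> {..n} - {k}"
      show "(c j - d j) * ?F j = 0"
      proof (cases "j < k")
        case True
        with less j show ?thesis by simp
      next
        case False
        with j have "?F j = 0" by (intro prod_zero) auto
        then show ?thesis by simp
      qed
    qed
  qed (use less.prems in auto)
  moreover have "?F k \<noteq> 0" by simp
  ultimately show ?case using eq by simp
qed

lemma rstirling_ex1: "\<exists>!c. rstirling_expansion r n c \<and> (\<forall>j>n. c j = 0)"
proof (rule ex_ex1I[OF rstirling_expansion_ex])
  fix c d
  assume "rstirling_expansion r n c \<and> (\<forall>j>n. c j = 0)"
    and "rstirling_expansion r n d \<and> (\<forall>j>n. d j = 0)"
  then show "c = d"
    by (metis ext not_le rstirling_expansion_unique)
qed

lemma rstirling_expansion_rstirling: "rstirling_expansion r n (rstirling r n)"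
  and rstirling_eq_0: "j > n \<Longrightarrow> rstirling r n j = 0"
  using theI'[OF rstirling_ex1[of r n]] by (auto simp: rstirling_def)

end

theory Submission
  imports Defs "HOL-Real_Asymp.Real_Asymp"
begin

text \<open>
  The recurrence \<open>B\<^sub>n\<^sub>+\<^sub>1 = (x + r) B\<^sub>n + x B\<^sub>n'\<close> says that the derivative of \<open>(-x)\<^sup>r e\<^sup>x B\<^sub>n(x)\<close> is
  \<open>(-x)\<^sup>r e\<^sup>x B\<^sub>n\<^sub>+\<^sub>1(x) / x\<close>. The former function vanishes at \<open>-\<infinity>\<close>, at the zeros of \<open>B\<^sub>n\<close> and at \<open>0\<close>, so
  Rolle's theorem yields \<open>n + 1\<close> distinct negative zeros of \<open>B\<^sub>n\<^sub>+\<^sub>1\<close>.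

  For the asymptotics, let \<open>b\<^sub>1 > b\<^sub>2 > \<dots> > 0\<close> be the numbers \<open>-1 / \<zeta>\<^sub>m\<close>. Their elementary symmetric sums
  are \<open>e\<^sub>k = S\<^sub>r(n+r, k+r) / r\<^sup>n\<close>, which for fixed \<open>k\<close> behave like \<open>((k + r) / r)\<^sup>n / k!\<close>; hence
  \<open>e\<^sub>m\<^sub>-\<^sub>i e\<^sub>m\<^sub>+\<^sub>i = o(e\<^sub>m\<^sup>2)\<close> for \<open>i > 0\<close>. By Graeffe's root squaring identity the sum of the squares of the
  \<open>m\<close>-fold products is then asymptotic to \<open>e\<^sub>m\<^sup>2\<close>, while it is at most \<open>b\<^sub>1 \<dots> b\<^sub>m e\<^sub>m\<close>, so
  \<open>b\<^sub>1 \<dots> b\<^sub>m\<close> is asymptotic to \<open>e\<^sub>m\<close>, and \<open>-1 / \<zeta>\<^sub>m\<close> to \<open>e\<^sub>m / e\<^sub>m\<^sub>-\<^sub>1\<close>.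
\<close>

section \<open>The polynomials\<close>

lemma rstirling_0_left: "rstirling r 0 j = (if j = 0 then 1 else 0)"
  using rstirling_expansion_rstirling[of r 0] rstirling_eq_0[of 0 j r]
  by (auto simp: rstirling_expansion_def)

text \<open>With \<open>F j\<close> the falling factorial of length \<open>j\<close>, one has
  \<open>(x + r) * F j = F (Suc j) + (real j + r) * F j\<close>; uniqueness of the expansion then
  identifies the coefficients.\<close>

lemma rstirling_Suc:
  "rstirling r (Suc n) j =
     (if j = 0 then 0 else rstirling r n (j - 1)) + (real j + r) * rstirling r n j"
proof -
  define d where
    "d j = (if j = 0 then 0 else rstirling r n (j - 1)) + (real j + r) * rstirling r n j" for j
  have "(x + r) ^ Suc n = (\<Sum>j\<le>Suc n. d j * (\<Prod>i<j. x - real i))" for x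
  proof -
    let ?F = "\<lambda>j. (\<Prod>i<j. x - real i)"
    have "(x + r) ^ Suc n = (\<Sum>j\<le>n. (x + r) * (rstirling r n j * ?F j))"
      using rstirling_expansion_rstirling[of r n]
      by (simp add: rstirling_expansion_def sum_distrib_left)
    also have "\<dots> = (\<Sum>j\<le>n. rstirling r n j * ?F (Suc j)) +
                     (\<Sum>j\<le>n. (real j + r) * rstirling r n j * ?F j)"
      unfolding sum.distrib[symmetric] by (intro sum.cong refl) (simp add: algebra_simps)
    also have "(\<Sum>j\<le>n. rstirling r n j * ?F (Suc j)) =
        (\<Sum>j\<le>Suc n. (if j = 0 then 0 else rstirling r n (j - 1)) * ?F j)"
      by (subst sum.atMost_Suc_shift) simp
    also have "(\<Sum>j\<le>n. (real j + r) * rstirling r n j * ?F j) =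
        (\<Sum>j\<le>Suc n. (real j + r) * rstirling r n j * ?F j)"
      by (simp add: rstirling_eq_0)
    finally show ?thesis
      by (simp only: d_def distrib_right sum.distrib)
  qed
  then have *: "rstirling_expansion r (Suc n) d"
    by (simp add: rstirling_expansion_def)
  show ?thesis
  proof (cases "j \<le> Suc n")
    case True
    then show ?thesis
      using rstirling_expansion_unique[OF rstirling_expansion_rstirling *] by (simp add: d_def)
  qed (simp add: rstirling_eq_0)
qed

lemma rstirling_nonneg: "r \<ge> 0 \<Longrightarrow> rstirling r n j \<ge> 0"
  by (induction n arbitrary: j) (auto simp: rstirling_0_left rstirling_Suc)

lemma rstirling_0_right: "rstirling r n 0 = r ^ n"
  by (induction n) (auto simp: rstirling_0_left rstirling_Suc)

lemma rstirling_diag: "rstirling r n n = 1"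
  by (induction n) (auto simp: rstirling_0_left rstirling_Suc rstirling_eq_0)

lemma rstirling_pos:
  assumes "r > 0" "j \<le> n"
  shows "rstirling r n j > 0"
  using assms(2)
proof (induction n arbitrary: j)
  case 0
  then show ?case by (simp add: rstirling_0_left)
next
  case (Suc n)
  show ?case
  proof (cases "j = Suc n")
    case False
    with Suc assms(1) have "(real j + r) * rstirling r n j > 0"
      by (intro mult_pos_pos) auto
    then show ?thesis
      using rstirling_nonneg[of r n "j - 1"] assms(1) by (cases "j = 0") (auto simp: rstirling_Suc)
  qed (simp add: rstirling_diag)
qed

text \<open>Evaluating the defining identity at \<open>x = k\<close> leaves only the terms with \<open>j \<le> k\<close>.\<close>

lemma rstirling_sum_fact:
  "(\<Sum>j\<le>k. rstirling r n j * (fact k / fact (k - j))) = (real k + r) ^ n"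
proof -
  let ?F = "\<lambda>j. (\<Prod>i<j. real k - real i)"
  have F: "?F j = fact k / fact (k - j)" if "j \<le> k" for j
    using that
  proof (induction j)
    case (Suc j)
    have "fact (k - j) = (real k - real j) * fact (k - Suc j)"
      using Suc.prems by (metis Suc_diff_le diff_Suc_Suc fact_Suc Suc_leD of_nat_diff)
    with Suc show ?case by (simp add: field_simps)
  qed simp
  have F0: "?F j = 0" if "j > k" for j
    using that by (intro prod_zero) auto
  have "(real k + r) ^ n = (\<Sum>j\<le>n. rstirling r n j * ?F j)"
    using rstirling_expansion_rstirling[of r n] by (simp add: rstirling_expansion_def)
  also have "\<dots> = (\<Sum>j\<le>n + k. rstirling r n j * ?F j)"
    by (rule sum.mono_neutral_left) (auto simp: rstirling_eq_0)
  also have "\<dots> = (\<Sum>j\<le>k. rstirling r n j * ?F j)"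
    by (rule sum.mono_neutral_right) (use F0 in auto)
  also have "\<dots> = (\<Sum>j\<le>k. rstirling r n j * (fact k / fact (k - j)))"
    by (intro sum.cong refl) (use F in auto)
  finally show ?thesis by simp
qed

text \<open>The identity at \<open>x = k\<close> is solved for its term \<open>j = k\<close> and
  divided by \<open>(k + r) ^ n\<close>; each term with \<open>j < k\<close> then carries the factor
  \<open>((j + r) / (k + r)) ^ n\<close>, which tends to 0.\<close>

lemma tendsto_rstirling:
  assumes "r > 0"
  shows "(\<lambda>n. rstirling r n k / (real k + r) ^ n) \<longlonglongrightarrow> 1 / fact k"
proof (induction k rule: less_induct)
  case (less k)
  have eq: "rstirling r n k / (real k + r) ^ n =
     (1 - (\<Sum>j<k. rstirling r n j / (real j + r) ^ n *
        ((real j + r) / (real k + r)) ^ n * (fact k / fact (k - j)))) / fact k" for n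
  proof -
    have "(real k + r) ^ n = (\<Sum>j<k. rstirling r n j * (fact k / fact (k - j))) +
            rstirling r n k * fact k"
      using rstirling_sum_fact[of r n k] by (simp add: lessThan_Suc_atMost[symmetric])
    moreover have "(real k + r) ^ n \<noteq> 0" using assms by (simp add: add_nonneg_eq_0_iff)
    ultimately have "1 = (\<Sum>j<k. rstirling r n j * (fact k / fact (k - j))) / (real k + r) ^ n +
            rstirling r n k * fact k / (real k + r) ^ n"
      unfolding add_divide_distrib[symmetric] by simp
    also have "(\<Sum>j<k. rstirling r n j * (fact k / fact (k - j))) / (real k + r) ^ n =
       (\<Sum>j<k. rstirling r n j / (real j + r) ^ n *
        ((real j + r) / (real k + r)) ^ n * (fact k / fact (k - j)))"
      unfolding sum_divide_distrib using assms
      by (intro sum.cong refl) (simp add: power_divide add_nonneg_eq_0_iff)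
    finally show ?thesis by (simp add: field_simps)
  qed
  have "(\<lambda>n. (1 - (\<Sum>j<k. rstirling r n j / (real j + r) ^ n *
        ((real j + r) / (real k + r)) ^ n * (fact k / fact (k - j)))) / fact k)
        \<longlonglongrightarrow> (1 - (\<Sum>j<k. 1 / fact j * 0 * (fact k / fact (k - j)))) / fact k"
    using assms by (intro tendsto_intros less.IH LIMSEQ_realpow_zero) auto
  then show ?case by (simp add: eq)
qed

lemma coeff_rbell: "coeff (rbell r n) j = rstirling r n j"
  by (auto simp: rbell_def coeff_sum rstirling_eq_0)

lemma degree_rbell: "degree (rbell r n) = n"
  by (rule order_antisym[OF degree_le le_degree])
     (auto simp: coeff_rbell rstirling_diag rstirling_eq_0)

lemma rbell_neq_0: "rbell r n \<noteq> 0"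
  by (metis coeff_0 coeff_rbell rstirling_diag zero_neq_one)

lemma poly_rbell_0: "poly (rbell r n) 0 = r ^ n"
  by (simp add: poly_0_coeff_0 coeff_rbell rstirling_0_right)

lemma rbell_Suc: "rbell r (Suc n) = [:r, 1:] * rbell r n + pCons 0 (pderiv (rbell r n))"
proof (rule poly_eqI)
  fix j show "coeff (rbell r (Suc n)) j =
      coeff ([:r, 1:] * rbell r n + pCons 0 (pderiv (rbell r n))) j"
    by (cases j) (auto simp: coeff_rbell rstirling_Suc coeff_pderiv algebra_simps)
qed

text \<open>All coefficients are nonnegative and the constant term \<open>r ^ n\<close> is positive,
  so the polynomial is positive at every \<open>x \<ge> 0\<close>.\<close>

lemma rbell_root_neg:
  assumes "r > 0" "poly (rbell r n) x = 0"
  shows "x < 0"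
proof (rule ccontr)
  assume "\<not> x < 0"
  then have "rstirling r n 0 * x ^ 0 \<le> (\<Sum>j\<le>n. rstirling r n j * x ^ j)"
    by (intro member_le_sum) (use assms in \<open>auto intro!: mult_nonneg_nonneg rstirling_nonneg\<close>)
  also have "\<dots> = poly (rbell r n) x"
    by (simp add: poly_altdef degree_rbell coeff_rbell)
  finally show False
    using assms by (simp add: rstirling_0_right) (metis not_less zero_less_power)
qed

section \<open>Simple real zeros\<close>

text \<open>Counting the elements of \<open>W\<close> below a given point is injective on \<open>S\<close> and never \<open>0\<close>.\<close>

lemma card_le_of_separated:
  fixes S W :: "'a :: linorder set"
  assumes W: "finite W"
    and below: "\<And>s. s \<in> S \<Longrightarrow> \<exists>w\<in>W. w < s"
    and between: "\<And>a b. a \<in> S \<Longrightarrow> b \<in> S \<Longrightarrow> a < b \<Longrightarrow> \<exists>w\<in>W. a < w \<and> w < b"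
  shows "card S \<le> card W"
proof -
  define f where "f s = card {w \<in> W. w < s}" for s
  have lt: "f a < f b" if "a \<in> S" "b \<in> S" "a < b" for a b
    unfolding f_def
  proof (rule psubset_card_mono)
    obtain w where "w \<in> W" "a < w" "w < b" using between \<open>a \<in> S\<close> \<open>b \<in> S\<close> \<open>a < b\<close> by blast
    then have "w \<in> {w \<in> W. w < b} - {w \<in> W. w < a}" by simp
    moreover have "{w \<in> W. w < a} \<subseteq> {w \<in> W. w < b}" using \<open>a < b\<close> by auto
    ultimately show "{w \<in> W. w < a} \<subset> {w \<in> W. w < b}" by blast
  qed (use W in auto)
  then have "inj_on f S"
    by (metis (no_types, lifting) inj_onI less_irrefl neqE)
  moreover have "f ` S \<subseteq> {1..card W}"
  proof
    fix y assume "y \<in> f ` S"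
    then obtain s where s: "s \<in> S" "y = f s" by auto
    obtain w where "w \<in> W" "w < s" using below[OF s(1)] by blast
    then have "f s \<noteq> 0" using W by (auto simp: f_def)
    moreover have "f s \<le> card W" unfolding f_def using W by (intro card_mono) auto
    ultimately show "y \<in> {1..card W}" using s(2) by simp
  qed
  ultimately have "card S \<le> card {1..card W}"
    by (metis card_inj_on_le finite_atLeastAtMost)
  then show ?thesis by simp
qed

text \<open>The base is \<open>- x\<close> because the function is studied for
  \<open>x \<le> 0\<close>. Since \<open>0 powr r = 0\<close>, it vanishes at 0 even when
  \<open>p\<close> does not.\<close>

definition weighted_poly :: "real \<Rightarrow> real poly \<Rightarrow> real \<Rightarrow> real" where
  "weighted_poly r p x = (- x) powr r * exp x * poly p x"

lemma weighted_poly_has_derivative: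
  assumes "x < 0"
  shows "(weighted_poly r p has_real_derivative
     (- x) powr r * exp x / x * poly ([:r, 1:] * p + pCons 0 (pderiv p)) x) (at x)"
  unfolding weighted_poly_def[abs_def]
  using assms
  by (auto intro!: derivative_eq_intros simp: powr_diff field_simps)

lemma continuous_on_weighted_poly:
  assumes "r > 0"
  shows "continuous_on {..0} (weighted_poly r p)"
  unfolding weighted_poly_def[abs_def]
  using assms by (intro continuous_intros continuous_on_powr') auto

lemma weighted_poly_at_bot: "(weighted_poly r p \<longlongrightarrow> 0) at_bot"
proof -
  have "((\<lambda>x. \<Sum>i\<le>degree p. coeff p i * ((- x) powr r * exp x * x ^ i)) \<longlongrightarrow>
          (\<Sum>i\<le>degree p. coeff p i * 0)) at_bot"
  proof (intro tendsto_intros)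
    fix i
    have "((\<lambda>x::real. x powr r * exp (- x) * x ^ i) \<longlongrightarrow> 0) at_top"
      by real_asymp
    \<comment> \<open>The limit at -\<infinity> comes from the one at \<infinity> by reflection; the
      sign turns \<open>x ^ i\<close> into \<open>(- x) ^ i\<close>.\<close>
    then have "((\<lambda>x::real. (- 1) ^ i * (x powr r * exp (- x) * x ^ i)) \<longlongrightarrow> (- 1) ^ i * 0) at_top"
      by (intro tendsto_intros)
    moreover have "(- 1) ^ i * (x powr r * exp (- x) * x ^ i) = (- (- x)) powr r * exp (- x) * (- x) ^ i"
      for x :: real
      unfolding power_minus[of x i] by (simp only: minus_minus mult_ac)
    ultimately show "((\<lambda>x::real. (- x) powr r * exp x * x ^ i) \<longlongrightarrow> 0) at_bot"
      unfolding filterlim_at_bot_mirror by simp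
  qed
  moreover have "(\<lambda>x. \<Sum>i\<le>degree p. coeff p i * ((- x) powr r * exp x * x ^ i)) = weighted_poly r p"
    by (auto simp: weighted_poly_def poly_altdef sum_distrib_left mult_ac)
  ultimately show ?thesis by simp
qed

lemma Rolle_weighted_poly:
  assumes "r > 0" "a < b" "b \<le> 0" "weighted_poly r p a = weighted_poly r p b"
  shows "\<exists>w. a < w \<and> w < b \<and> poly ([:r, 1:] * p + pCons 0 (pderiv p)) w = 0"
proof -
  have "\<exists>w>a. w < b \<and> (weighted_poly r p has_real_derivative 0) (at w)"
  proof (rule Rolle)
    show "continuous_on {a..b} (weighted_poly r p)"
      using assms by (intro continuous_on_subset[OF continuous_on_weighted_poly]) auto
    show "weighted_poly r p differentiable at x" if "a < x" "x < b" for x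
      using weighted_poly_has_derivative[of x r p] that assms
      by (auto simp: real_differentiable_def)
  qed (use assms in auto)
  then obtain w where w: "a < w" "w < b" "(weighted_poly r p has_real_derivative 0) (at w)"
    by blast
  then have "w < 0" using assms by simp
  with DERIV_unique[OF w(3) weighted_poly_has_derivative] have
    "(- w) powr r * exp w / w * poly ([:r, 1:] * p + pCons 0 (pderiv p)) w = 0" by metis
  with \<open>w < 0\<close> have "poly ([:r, 1:] * p + pCons 0 (pderiv p)) w = 0"
    by simp
  with w show ?thesis by blast
qed

text \<open>The function tends to 0 at -\<infinity> and vanishes at \<open>b\<close>, so it takes
  some value twice up to \<open>b\<close>; Rolle's theorem applies between those two points.\<close>

lemma Rolle_weighted_poly_at_bot:
  assumes "r > 0" "p \<noteq> 0" "b \<le> 0" "weighted_poly r p b = 0"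
  shows "\<exists>w. w < b \<and> poly ([:r, 1:] * p + pCons 0 (pderiv p)) w = 0"
proof -
  let ?g = "weighted_poly r p"
  have "infinite ({..<b} - {x. poly p x = 0})"
    using assms(2) poly_roots_finite infinite_Iio by (intro Diff_infinite_finite) auto
  then obtain y where y: "y < b" "poly p y \<noteq> 0"
    by (metis (mono_tags, lifting) Diff_iff finite.emptyI lessThan_iff mem_Collect_eq ex_in_conv)
  then have gy: "?g y \<noteq> 0" using assms by (simp add: weighted_poly_def)
  have "eventually (\<lambda>x. \<bar>?g x\<bar> < \<bar>?g y\<bar>) at_bot"
    using tendstoD[OF weighted_poly_at_bot, of "\<bar>?g y\<bar>" r p] gy by (simp add: dist_real_def)
  then have "eventually (\<lambda>x. \<bar>?g x\<bar> < \<bar>?g y\<bar> \<and> x < y) at_bot"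
    by (intro eventually_conj eventually_gt_at_bot)
      (auto simp: eventually_at_bot_dense intro: exI[of _ y])
  then obtain u where u: "\<bar>?g u\<bar> < \<bar>?g y\<bar>" "u < y"
    using eventually_happens' trivial_limit_at_bot_linorder by blast
  have c: "continuous_on {a..b} ?g" for a
    using assms by (intro continuous_on_subset[OF continuous_on_weighted_poly]) auto
  \<comment> \<open>A zero in \<open>[u, y]\<close> is paired with \<open>b\<close>. Otherwise
    \<open>?g u\<close> and \<open>?g y\<close> have the same sign and \<open>?g u\<close> is nearer
    to 0, so the value \<open>?g u\<close> recurs between \<open>y\<close> and \<open>b\<close>,
    where \<open>?g b = 0\<close>.\<close>
  have "\<exists>a v. a < v \<and> v \<le> b \<and> ?g a = ?g v"
  proof (cases "\<exists>a\<in>{u..y}. ?g a = 0")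
    case True
    then obtain a where "a \<le> y" "?g a = 0" by auto
    then show ?thesis using y assms(4) by (intro exI[of _ a] exI[of _ b]) auto
  next
    case False
    then have "?g u > 0 \<and> ?g y > 0 \<or> ?g u < 0 \<and> ?g y < 0"
      using IVT'[of ?g u 0 y] IVT2'[of ?g y 0 u] u(2) continuous_on_subset[OF c[of u], of "{u..y}"] y(1)
      by force
    then have "\<exists>v\<ge>y. v \<le> b \<and> ?g v = ?g u"
      using IVT2'[of ?g b "?g u" y] IVT'[of ?g y "?g u" b] c[of y] y(1) u(1) assms(4) by force
    then show ?thesis using u(2) by (metis less_le_trans)
  qed
  then obtain a v where "a < v" "v \<le> b" "?g a = ?g v" by blast
  with Rolle_weighted_poly[of r a v p] assms show ?thesis by force
qed

theorem card_rbell_roots: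
  assumes "r > 0"
  shows "card {x. poly (rbell r n) x = 0} = n"
proof (induction n)
  case 0
  then show ?case by (simp add: rbell_def rstirling_diag)
next
  case (Suc n)
  let ?Z = "{x. poly (rbell r n) x = 0}" and ?W = "{x. poly (rbell r (Suc n)) x = 0}"
  have fin: "finite ?Z" "finite ?W"
    by (auto intro!: poly_roots_finite rbell_neq_0)
  have S: "s \<le> 0" "weighted_poly r (rbell r n) s = 0" if "s \<in> insert 0 ?Z" for s
    using that rbell_root_neg[OF assms, of n s] by (auto simp: weighted_poly_def)
  \<comment> \<open>\<open>insert 0 ?Z\<close> has \<open>n + 1\<close> points; any two are
    separated by a zero of the next polynomial, and a further zero lies below them all. The degree
    gives the opposite bound.\<close>
  have "card (insert 0 ?Z) \<le> card ?W"
  proof (rule card_le_of_separated)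
    fix s assume "s \<in> insert 0 ?Z"
    then show "\<exists>w\<in>?W. w < s"
      using Rolle_weighted_poly_at_bot[OF assms rbell_neq_0, of s r n] S
      by (auto simp: rbell_Suc)
  next
    fix a b assume "a \<in> insert 0 ?Z" "b \<in> insert 0 ?Z" "a < b"
    then show "\<exists>w\<in>?W. a < w \<and> w < b"
      using Rolle_weighted_poly[OF assms, of a b "rbell r n"] S
      by (force simp: rbell_Suc)
  qed (use fin in auto)
  moreover have "0 \<notin> ?Z" using assms by (simp add: poly_rbell_0)
  ultimately have "Suc n \<le> card ?W" using fin Suc by simp
  moreover have "card ?W \<le> Suc n"
    using card_poly_roots_bound[OF rbell_neq_0[of r "Suc n"]] by (simp add: degree_rbell)
  ultimately show ?case by simp
qed

lemma poly_eq_prod_roots: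
  fixes p :: "'a :: field poly"
  assumes "p \<noteq> 0" "card {x. poly p x = 0} = degree p"
  shows "p = smult (lead_coeff p) (\<Prod>x\<in>{x. poly p x = 0}. [:- x, 1:])"
  using assms
proof (induction "degree p" arbitrary: p)
  case 0
  then have "{x. poly p x = 0} = {}" by (metis card_0_eq poly_roots_finite)
  then show ?case using 0 
    by (metis degree_0_id mult.right_neutral prod.empty smult_0_right smult_one smult_pCons one_pCons)
next
  case (Suc d)
  then obtain a where a: "poly p a = 0"
    by (metis (mono_tags) card.empty empty_Collect_eq nat.distinct(1))
  then obtain q where q: "p = [:- a, 1:] * q" by (metis dvdE poly_eq_0_iff_dvd)
  with Suc have "q \<noteq> 0" by auto
  then have d: "degree p = Suc (degree q)" unfolding q by (subst degree_mult_eq) auto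
  let ?Z = "{x. poly q x = 0}"
  have Z: "{x. poly p x = 0} = insert a ?Z" unfolding q by auto
  have fin: "finite ?Z" using \<open>q \<noteq> 0\<close> poly_roots_finite by blast
  have le: "card ?Z \<le> degree q" by (rule card_poly_roots_bound[OF \<open>q \<noteq> 0\<close>])
  \<comment> \<open>\<open>p\<close> has \<open>degree q + 1\<close> zeros and \<open>q\<close> at
    most \<open>degree q\<close>, so \<open>a\<close> is not a zero of \<open>q\<close>, and
    \<open>q\<close> again has as many zeros as its degree.\<close>
  have "card (insert a ?Z) = Suc (degree q)" using Suc.prems Z d by simp
  with le fin have na: "a \<notin> ?Z" and c: "card ?Z = degree q"
    by (auto simp: card_insert_if split: if_splits)
  have "q = smult (lead_coeff q) (\<Prod>x\<in>?Z. [:- x, 1:])"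
    using Suc.hyps d \<open>q \<noteq> 0\<close> c by simp
  moreover have "lead_coeff p = lead_coeff q" unfolding q by (subst lead_coeff_mult) simp
  moreover have "(\<Prod>x\<in>{x. poly p x = 0}. [:- x, 1:]) = [:- a, 1:] * (\<Prod>x\<in>?Z. [:- x, 1:])"
    unfolding Z by (subst prod.insert) (use fin na in auto)
  ultimately show ?case using q by (metis mult_smult_right)
qed

text \<open>Each linear factor occurs once in the factorization, so the product over the other zeros
  does not vanish at \<open>a\<close> and contributes order 0.\<close>

lemma order_eq_1_of_card_roots:
  fixes p :: "'a :: field poly"
  assumes "p \<noteq> 0" "card {x. poly p x = 0} = degree p" "poly p a = 0"
  shows "order a p = 1"
proof -
  let ?Z = "{x. poly p x = 0}"
  let ?q = "\<Prod>x\<in>?Z - {a}. [:- x, 1:]"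
  have fin: "finite ?Z" using assms(1) poly_roots_finite by blast
  have "p = smult (lead_coeff p) ([:- a, 1:] * ?q)"
    using poly_eq_prod_roots[OF assms(1,2)] prod.remove[OF fin, of a "\<lambda>x. [:- x, 1:]"] assms(3)
    by simp
  then have "order a p = order a ([:- a, 1:] * ?q)"
    using assms(1) by (metis leading_coeff_0_iff order_smult)
  also have nz: "?q \<noteq> 0" using fin by auto
  then have "order a ([:- a, 1:] * ?q) = order a [:- a, 1:] + order a ?q"
    by (intro order_mult no_zero_divisors) auto
  also have "order a ?q = 0"
    using fin by (intro order_0I) (auto simp: poly_prod)
  also have "order a [:- a, 1:] = 1"
    using order_power_n_n[of a 1] by simp
  finally show ?thesis by simp
qed

section \<open>Elementary symmetric sums\<close>

text \<open>Values are read through \<open>b\<close> on an index set, so that one set serves for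
  \<open>b\<close>, its negative and its square, and repeated values count separately.\<close>

definition esym :: "('b \<Rightarrow> 'a :: comm_semiring_1) \<Rightarrow> 'b set \<Rightarrow> nat \<Rightarrow> 'a" where
  "esym b A k = (\<Sum>X | X \<subseteq> A \<and> card X = k. \<Prod>x\<in>X. b x)"

text \<open>The product is expanded over subsets, which are grouped by cardinality. The exponent
  \<open>d\<close> is left general because root squaring uses both \<open>d = 1\<close> and
  \<open>d = 2\<close>.\<close>

lemma prod_1_plus_monom:
  fixes b :: "'b \<Rightarrow> 'a :: comm_semiring_1"
  assumes "finite A"
  shows "(\<Prod>x\<in>A. 1 + monom (b x) d) = (\<Sum>k\<le>card A. monom (esym b A k) (d * k))"
proof -
  have mono: "(\<Prod>x\<in>X. monom (b x) d) = monom (\<Prod>x\<in>X. b x) (d * card X)"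
    if "finite X" for X
    using that by (induction X rule: finite_induct) (auto simp: mult_monom add.commute)
  have "(\<Prod>x\<in>A. 1 + monom (b x) d) = (\<Sum>X\<in>Pow A. \<Prod>x\<in>X. monom (b x) d)"
    using prod_add[OF assms, of "\<lambda>x. monom (b x) d" "\<lambda>_. 1"] by (simp add: add.commute)
  also have "\<dots> = (\<Sum>X\<in>Pow A. monom (\<Prod>x\<in>X. b x) (d * card X))"
    using assms by (intro sum.cong refl mono) (auto intro: finite_subset)
  also have "\<dots> = (\<Sum>k\<le>card A. \<Sum>X | X \<in> Pow A \<and> card X = k. monom (\<Prod>x\<in>X. b x) (d * card X))"
    by (rule sum.group[symmetric]) (use assms in \<open>auto intro: card_mono\<close>)
  also have "\<dots> = (\<Sum>k\<le>card A. monom (esym b A k) (d * k))"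
    unfolding esym_def monom_sum by (intro sum.cong) auto
  finally show ?thesis .
qed

lemma esym_eq_0: "finite A \<Longrightarrow> k > card A \<Longrightarrow> esym b A k = 0"
  unfolding esym_def by (rule sum.neutral) (auto dest: card_mono)

lemma coeff_prod_1_plus_monom:
  assumes "finite A" "d > 0"
  shows "coeff (\<Prod>x\<in>A. 1 + monom (b x) d) (d * k) = esym b A k"
  using assms esym_eq_0[OF assms(1), of k b]
  by (auto simp: prod_1_plus_monom coeff_sum if_distrib cong: if_cong)

lemma esym_nonneg:
  fixes b :: "'b \<Rightarrow> 'a :: linordered_idom"
  shows "(\<And>x. x \<in> A \<Longrightarrow> b x \<ge> 0) \<Longrightarrow> esym b A k \<ge> 0"
  unfolding esym_def by (intro sum_nonneg prod_nonneg) auto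

lemma esym_uminus:
  fixes b :: "'b \<Rightarrow> 'a :: comm_ring_1"
  shows "esym (\<lambda>x. - b x) A k = (- 1) ^ k * esym b A k"
  unfolding esym_def sum_distrib_left by (intro sum.cong refl) (auto simp: prod_uminus)

text \<open>Graeffe's root squaring identity, from \<open>\<Prod>(1 + b X) \<cdot> \<Prod>(1 - b X) = \<Prod>(1 - b\<^sup>2 X\<^sup>2)\<close>.\<close>

lemma esym_square:
  fixes b :: "'b \<Rightarrow> 'a :: comm_ring_1"
  assumes "finite A"
  shows "esym (\<lambda>x. (b x)\<^sup>2) A m =
     (\<Sum>i\<le>2 * m. (- 1) ^ (m + i) * esym b A i * esym b A (2 * m - i))"
proof -
  have "(\<Prod>x\<in>A. 1 + monom (b x) 1) * (\<Prod>x\<in>A. 1 + monom (- b x) 1) =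
        (\<Prod>x\<in>A. 1 + monom (- ((b x)\<^sup>2)) 2)"
    unfolding prod.distrib[symmetric]
    by (intro prod.cong refl)
       (simp add: algebra_simps mult_monom power2_eq_square numeral_2_eq_2 flip: minus_monom)
  then have "coeff ((\<Prod>x\<in>A. 1 + monom (b x) 1) * (\<Prod>x\<in>A. 1 + monom (- b x) 1)) (2 * m) =
      esym (\<lambda>x. - ((b x)\<^sup>2)) A m"
    using coeff_prod_1_plus_monom[OF assms, of 2 "\<lambda>x. - ((b x)\<^sup>2)" m] by (simp only:)
  then have "(\<Sum>i\<le>2 * m. esym b A i * ((- 1) ^ (2 * m - i) * esym b A (2 * m - i))) =
      (- 1) ^ m * esym (\<lambda>x. (b x)\<^sup>2) A m"
    using coeff_prod_1_plus_monom[OF assms, of 1 b] coeff_prod_1_plus_monom[OF assms, of 1 "\<lambda>x. - b x"]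
    by (simp add: coeff_mult esym_uminus)
  \<comment> \<open>The exponents \<open>m + (2 * m - i)\<close> and \<open>m + i\<close> have the
    same parity.\<close>
  moreover have "(- 1) ^ m * (esym b A i * ((- 1) ^ (2 * m - i) * esym b A (2 * m - i))) =
      (- 1) ^ (m + i) * esym b A i * esym b A (2 * m - i)" if "i \<le> 2 * m" for i
    using that by (auto simp: minus_one_power_iff)
  ultimately have "(\<Sum>i\<le>2 * m. (- 1) ^ (m + i) * esym b A i * esym b A (2 * m - i)) =
      (- 1) ^ m * ((- 1) ^ m * esym (\<lambda>x. (b x)\<^sup>2) A m)"
    by (metis (no_types, lifting) atMost_iff sum.cong sum_distrib_left)
  then show ?thesis
    by (simp add: minus_one_power_iff split: if_splits)
qed

text \<open>Exchange argument: the common part \<open>S \<inter> T\<close> is set aside, and a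
  bijection from \<open>S - T\<close> to \<open>T - S\<close> replaces each factor by one at least
  as large.\<close>

lemma prod_le_prod_top:
  fixes b :: "'b \<Rightarrow> 'a :: linordered_field"
  assumes "finite A" "S \<subseteq> A" "T \<subseteq> A" "card S = card T"
    and nonneg: "\<And>x. x \<in> A \<Longrightarrow> b x \<ge> 0"
    and top: "\<And>x y. x \<in> T \<Longrightarrow> y \<in> A - T \<Longrightarrow> b y \<le> b x"
  shows "prod b S \<le> prod b T"
proof -
  have fin: "finite S" "finite T" using assms finite_subset by auto
  have "card (S - T) = card (T - S)"
    using assms(4) fin by (simp add: card_Diff_subset_Int Int_commute)
  then obtain f where f: "bij_betw f (S - T) (T - S)"
    using finite_same_card_bij[of "S - T" "T - S"] fin by auto
  have "prod b (S - T) \<le> prod (b \<circ> f) (S - T)"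
  proof (rule prod_mono)
    fix y assume y: "y \<in> S - T"
    then have "f y \<in> T" using f by (auto dest: bij_betwE)
    then show "0 \<le> b y \<and> b y \<le> (b \<circ> f) y" using y nonneg top assms(2) by auto
  qed
  also have "prod (b \<circ> f) (S - T) = prod b (T - S)"
    using prod.reindex_bij_betw[OF f, of b] by simp
  finally have "prod b (S \<inter> T) * prod b (S - T) \<le> prod b (S \<inter> T) * prod b (T - S)"
    using nonneg assms(2) by (intro mult_left_mono prod_nonneg) auto
  then show ?thesis
    using prod.Int_Diff[OF fin(1), of b T] prod.Int_Diff[OF fin(2), of b S]
    by (simp add: Int_commute)
qed

text \<open>The products of \<open>m\<close> numbers are bounded by the largest one, so their sum of squares is at
  most \<open>prod b T * esym b A m\<close>; the squaring identity bounds that sum from below.\<close>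

lemma prod_top_bounds:
  fixes b :: "'b \<Rightarrow> 'a :: linordered_field"
  assumes "finite A" "T \<subseteq> A" "card T = m"
    and nonneg: "\<And>x. x \<in> A \<Longrightarrow> b x \<ge> 0"
    and top: "\<And>x y. x \<in> T \<Longrightarrow> y \<in> A - T \<Longrightarrow> b y \<le> b x"
  shows "prod b T \<le> esym b A m"
    and "(esym b A m)\<^sup>2 \<le> prod b T * esym b A m +
           (\<Sum>i\<in>{..2 * m} - {m}. esym b A i * esym b A (2 * m - i))"
proof -
  let ?e = "esym b A"
  have fin: "finite {X. X \<subseteq> A \<and> card X = m}" using assms(1) by simp
  show "prod b T \<le> ?e m"
    unfolding esym_def
    by (rule member_le_sum) (use fin assms in \<open>auto intro!: prod_nonneg\<close>)
  \<comment> \<open>The term \<open>i = m\<close> of the squaring identity has sign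
    \<open>+1\<close> and equals the square; the remaining terms are then bounded by their absolute
    values.\<close>
  have "(?e m)\<^sup>2 = esym (\<lambda>x. (b x)\<^sup>2) A m -
      (\<Sum>i\<in>{..2 * m} - {m}. (- 1) ^ (m + i) * ?e i * ?e (2 * m - i))"
    unfolding esym_square[OF assms(1)]
    by (subst sum.remove[of _ m]) (auto simp: power2_eq_square mult_2[symmetric])
  also have "\<dots> \<le> esym (\<lambda>x. (b x)\<^sup>2) A m + (\<Sum>i\<in>{..2 * m} - {m}. ?e i * ?e (2 * m - i))"
  proof -
    have "- (\<Sum>i\<in>{..2 * m} - {m}. (- 1) ^ (m + i) * ?e i * ?e (2 * m - i)) =
        (\<Sum>i\<in>{..2 * m} - {m}. - ((- 1) ^ (m + i) * ?e i * ?e (2 * m - i)))"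
      by (simp add: sum_negf)
    also have "\<dots> \<le> (\<Sum>i\<in>{..2 * m} - {m}. ?e i * ?e (2 * m - i))"
      by (intro sum_mono) (auto simp: minus_one_power_iff esym_nonneg nonneg)
    finally show ?thesis by simp
  qed
  also have "esym (\<lambda>x. (b x)\<^sup>2) A m \<le> prod b T * ?e m"
    unfolding esym_def sum_distrib_left
  proof (rule sum_mono)
    fix X assume X: "X \<in> {X. X \<subseteq> A \<and> card X = m}"
    then have "prod b X \<le> prod b T"
      using assms by (intro prod_le_prod_top[of A]) auto
    moreover have "prod b X \<ge> 0" using X nonneg by (auto intro: prod_nonneg)
    moreover have "(\<Prod>x\<in>X. (b x)\<^sup>2) = prod b X * prod b X"
      by (simp only: prod_power_distrib flip: power2_eq_square)
    ultimately show "(\<Prod>x\<in>X. (b x)\<^sup>2) \<le> prod b T * prod b X"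
      by (simp only: mult_right_mono)
  qed
  finally show "(?e m)\<^sup>2 \<le> prod b T * ?e m + (\<Sum>i\<in>{..2 * m} - {m}. ?e i * ?e (2 * m - i))"
    by simp
qed

section \<open>Asymptotics of the zeros\<close>

text \<open>Writing each factor \<open>X - x\<close> as \<open>- x * (1 - X / x)\<close> turns the
  coefficients into symmetric sums of \<open>- (1 / x)\<close> times the product of all
  \<open>- x\<close>. The constant term shows that this product is \<open>r ^ n\<close>.\<close>

lemma rstirling_eq_esym:
  assumes "r > 0"
  shows "rstirling r n k = r ^ n * esym (\<lambda>x. - (1 / x)) {x. poly (rbell r n) x = 0} k"
proof -
  let ?p = "rbell r n"
  let ?Z = "{x. poly ?p x = 0}"
  have fin: "finite ?Z" by (intro poly_roots_finite rbell_neq_0)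
  have "[:- x, 1:] = smult (- x) (1 + monom (- (1 / x)) 1)" if "x \<in> ?Z" for x
    using rbell_root_neg[OF assms, of n x] that
    by (simp add: smult_add_right smult_monom monom_Suc monom_0 one_pCons)
  then have "(\<Prod>x\<in>?Z. [:- x, 1:]) = (\<Prod>x\<in>?Z. smult (- x) (1 + monom (- (1 / x)) 1))"
    by (rule prod.cong[OF refl])
  then have "?p = smult (lead_coeff ?p) (\<Prod>x\<in>?Z. smult (- x) (1 + monom (- (1 / x)) 1))"
    using poly_eq_prod_roots[OF rbell_neq_0[of r n]] card_rbell_roots[OF assms, of n]
    by (simp only: degree_rbell)
  also have "\<dots> = smult (\<Prod>x\<in>?Z. - x) (\<Prod>x\<in>?Z. 1 + monom (- (1 / x)) 1)"
    by (simp only: prod_smult degree_rbell coeff_rbell rstirling_diag smult_1_left)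
  finally have p: "?p = smult (\<Prod>x\<in>?Z. - x) (\<Prod>x\<in>?Z. 1 + monom (- (1 / x)) 1)" .
  have c: "rstirling r n j = (\<Prod>x\<in>?Z. - x) * esym (\<lambda>x. - (1 / x)) ?Z j" for j
    using arg_cong[OF p, of "\<lambda>p. coeff p j"]
      coeff_prod_1_plus_monom[OF fin, of 1 "\<lambda>x. - (1 / x)" j]
    by (simp add: coeff_rbell)
  have "{X. X \<subseteq> ?Z \<and> card X = 0} = {{}}"
    using fin by (auto dest: finite_subset)
  then have "(\<Prod>x\<in>?Z. - x) = r ^ n"
    using c[of 0] by (simp add: esym_def rstirling_0_right)
  with c show ?thesis by simp
qed

text \<open>This is the product \<open>b\<^sub>1 \<dots> b\<^sub>m\<close>: the reversed list starts
  with the largest zeros, and on negative numbers \<open>- (1 / x)\<close> increases with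
  \<open>x\<close>.\<close>

definition top_prod :: "real \<Rightarrow> nat \<Rightarrow> nat \<Rightarrow> real" where
  "top_prod r m n =
     (\<Prod>x\<in>set (take m (rev (sorted_list_of_set {x. poly (rbell r n) x = 0}))). - (1 / x))"

text \<open>Zeros are counted from 1 and list entries from 0, so the entry at \<open>k\<close> is
  zero number \<open>Suc k\<close>. It is a new element because the list is distinct.\<close>

lemma top_prod_Suc:
  assumes "r > 0" "k < n"
  shows "top_prod r (Suc k) n = - (1 / rbell_zero r (Suc k) n) * top_prod r k n"
proof -
  let ?L = "rev (sorted_list_of_set {x. poly (rbell r n) x = 0})"
  have len: "k < length ?L" using assms by (simp add: card_rbell_roots)
  have "distinct (take (Suc k) ?L)" by simp
  then have "?L ! k \<notin> set (take k ?L)"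
    unfolding take_Suc_conv_app_nth[OF len] by simp
  then show ?thesis
    using len by (simp add: top_prod_def rbell_zero_def take_Suc_conv_app_nth)
qed

text \<open>These are the bounds of \<open>prod_top_bounds\<close> for
  \<open>b x = - (1 / x)\<close>. Division by the square of the \<open>m\<close>-th symmetric sum
  cancels the powers of \<open>r\<close> in the error sum.\<close>

lemma top_prod_bounds:
  assumes "r > 0" "m \<le> n"
  shows "top_prod r m n > 0"
    and "top_prod r m n \<le> rstirling r n m / r ^ n"
    and "1 \<le> top_prod r m n / (rstirling r n m / r ^ n) +
           (\<Sum>i\<in>{..2 * m} - {m}. rstirling r n i * rstirling r n (2 * m - i) / (rstirling r n m)\<^sup>2)"
proof -
  let ?Z = "{x. poly (rbell r n) x = 0}"
  let ?L = "rev (sorted_list_of_set ?Z)"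
  let ?T = "set (take m ?L)"
  let ?b = "\<lambda>x::real. - (1 / x)"
  have fin: "finite ?Z" by (intro poly_roots_finite rbell_neq_0)
  have TZ: "?T \<subseteq> ?Z" using fin set_take_subset[of m ?L] by auto
  have neg: "x < 0" if "x \<in> ?Z" for x using rbell_root_neg[OF assms(1)] that by auto
  have "card ?T = m"
    using assms by (subst distinct_card) (auto simp: card_rbell_roots)
  moreover have "?b y \<le> ?b x" if "x \<in> ?T" "y \<in> ?Z - ?T" for x y
  proof -
    have "y \<in> set (drop m ?L)"
      using that fin by (metis Diff_iff Un_iff append_take_drop_id set_append set_rev
          set_sorted_list_of_set)
    moreover have "sorted_wrt (\<ge>) (take m ?L @ drop m ?L)"
      by (simp add: sorted_wrt_rev)
    ultimately have "y \<le> x" using that(1) unfolding sorted_wrt_append by blast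
    moreover have "x < 0" "y < 0" using that TZ neg by auto
    ultimately show ?thesis by (simp add: field_simps)
  qed
  ultimately have *: "top_prod r m n \<le> esym ?b ?Z m"
    "(esym ?b ?Z m)\<^sup>2 \<le> top_prod r m n * esym ?b ?Z m +
           (\<Sum>i\<in>{..2 * m} - {m}. esym ?b ?Z i * esym ?b ?Z (2 * m - i))"
    unfolding top_prod_def using prod_top_bounds[of ?Z ?T m ?b] fin TZ neg
    by (auto simp: less_imp_le)
  show "top_prod r m n > 0"
    unfolding top_prod_def using TZ neg by (intro prod_pos) auto
  have e: "esym ?b ?Z i = rstirling r n i / r ^ n" for i
    using assms rstirling_eq_esym[of r n i] by simp
  show "top_prod r m n \<le> rstirling r n m / r ^ n" using * e by simp
  have pos: "rstirling r n m > 0" using rstirling_pos assms by blast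
  let ?s = "\<lambda>i. rstirling r n i / r ^ n"
  have "?s m > 0" using pos assms by simp
  with *(2) have "1 \<le> (top_prod r m n * ?s m + (\<Sum>i\<in>{..2 * m} - {m}. ?s i * ?s (2 * m - i))) / (?s m)\<^sup>2"
    unfolding e by (subst le_divide_eq_1_pos) (simp_all only: zero_less_power)
  also have "\<dots> = top_prod r m n * ?s m / (?s m)\<^sup>2 +
      (\<Sum>i\<in>{..2 * m} - {m}. ?s i * ?s (2 * m - i) / (?s m)\<^sup>2)"
    by (simp only: add_divide_distrib sum_divide_distrib)
  also have "top_prod r m n * ?s m / (?s m)\<^sup>2 = top_prod r m n / ?s m"
    using \<open>?s m > 0\<close> by (simp add: power2_eq_square)
  also have "(\<lambda>i. ?s i * ?s (2 * m - i) / (?s m)\<^sup>2) =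
      (\<lambda>i. rstirling r n i * rstirling r n (2 * m - i) / (rstirling r n m)\<^sup>2)"
    using assms(1) by (simp add: power2_eq_square)
  finally show "1 \<le> top_prod r m n / ?s m +
      (\<Sum>i\<in>{..2 * m} - {m}. rstirling r n i * rstirling r n (2 * m - i) / (rstirling r n m)\<^sup>2)" .
qed

text \<open>With \<open>j = 2 * m - i\<close>, the quotient behaves like a constant times
  \<open>?q ^ n\<close>, and \<open>?q < 1\<close> by the inequality of arithmetic and geometric
  means.\<close>

lemma tendsto_rstirling_ratio:
  assumes "r > 0" "i \<le> 2 * m" "i \<noteq> m"
  shows "(\<lambda>n. rstirling r n i * rstirling r n (2 * m - i) / (rstirling r n m)\<^sup>2) \<longlonglongrightarrow> 0"
proof -
  define j where "j = 2 * m - i"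
  let ?s = "\<lambda>k n. rstirling r n k / (real k + r) ^ n"
  let ?q = "(real i + r) * (real j + r) / (real m + r)\<^sup>2"
  have "real i + real j = 2 * real m" using assms(2) by (simp add: j_def)
  then have j: "real j = 2 * real m - real i" by simp
  \<comment> \<open>The defect in that inequality is exactly
    \<open>(real m - real i)\<^sup>2\<close>, which is positive as
    \<open>i \<noteq> m\<close>.\<close>
  have "(real i + r) * (real j + r) + (real m - real i)\<^sup>2 = (real m + r)\<^sup>2"
    unfolding j by (simp add: power2_eq_square algebra_simps)
  moreover have "(real m - real i)\<^sup>2 > 0" using assms(3) by simp
  ultimately have "(real i + r) * (real j + r) < (real m + r)\<^sup>2" by linarith
  then have q: "?q < 1" using assms(1) by (simp add: divide_less_eq)
  have "(\<lambda>n. ?s i n * ?s j n / (?s m n)\<^sup>2 * ?q ^ n) \<longlonglongrightarrow> 1 / fact i * (1 / fact j) / (1 / fact m)\<^sup>2 * 0"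
    using assms(1) q by (intro tendsto_intros tendsto_rstirling LIMSEQ_realpow_zero) auto
  moreover have "?s i n * ?s j n / (?s m n)\<^sup>2 * ?q ^ n =
      rstirling r n i * rstirling r n j / (rstirling r n m)\<^sup>2" for n
  proof -
    have "real i + r \<noteq> 0" "real j + r \<noteq> 0" "real m + r \<noteq> 0" using assms(1) by linarith+
    then show ?thesis
      by (simp add: power_divide power_mult_distrib power2_eq_square)
  qed
  ultimately show ?thesis by (simp add: j_def)
qed

lemma tendsto_top_prod:
  assumes "r > 0"
  shows "(\<lambda>n. top_prod r m n / (rstirling r n m / r ^ n)) \<longlonglongrightarrow> 1"
proof (rule tendsto_sandwich)
  let ?R = "\<lambda>n. \<Sum>i\<in>{..2 * m} - {m}. rstirling r n i * rstirling r n (2 * m - i) / (rstirling r n m)\<^sup>2"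
  have "?R \<longlonglongrightarrow> (\<Sum>i\<in>{..2 * m} - {m}. 0)"
    using assms by (intro tendsto_sum tendsto_rstirling_ratio) auto
  then have "(\<lambda>n. 1 - ?R n) \<longlonglongrightarrow> 1 - 0" by (intro tendsto_diff tendsto_const) simp
  then show "(\<lambda>n. 1 - ?R n) \<longlonglongrightarrow> 1" by simp
  show "eventually (\<lambda>n. 1 - ?R n \<le> top_prod r m n / (rstirling r n m / r ^ n)) sequentially"
    using eventually_ge_at_top[of m]
    by eventually_elim (use top_prod_bounds(3)[OF assms] in \<open>simp add: diff_le_eq\<close>)
  show "eventually (\<lambda>n. top_prod r m n / (rstirling r n m / r ^ n) \<le> 1) sequentially"
    using eventually_ge_at_top[of m]
  proof eventually_elim
    case (elim n)
    then have "rstirling r n m / r ^ n > 0" using rstirling_pos assms by simp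
    then show ?case using top_prod_bounds(2)[OF assms elim] by (simp only: divide_le_eq_1_pos)
  qed
qed simp

text \<open>The zero is minus the quotient of two consecutive top products. In their asymptotics
  \<open>r ^ n\<close> cancels, the rates \<open>(k + r) ^ n\<close> and
  \<open>(Suc k + r) ^ n\<close> give the geometric factor, and the factorials give
  \<open>Suc k\<close>.\<close>

lemma tendsto_rbell_zero:
  assumes "r > 0"
  shows "(\<lambda>n. rbell_zero r (Suc k) n / (- real (Suc k) *
           ((real (Suc k) + r - 1) / (real (Suc k) + r)) ^ n)) \<longlonglongrightarrow> 1"
proof -
  let ?s = "\<lambda>k n. rstirling r n k / (real k + r) ^ n"
  let ?t = "\<lambda>k n. top_prod r k n / (rstirling r n k / r ^ n)"
  let ?m = "Suc k"
  have "(\<lambda>n. (?t k n / ?t ?m n) * (?s k n / ?s ?m n) / real ?m) \<longlonglongrightarrow>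
      (1 / 1) * ((1 / fact k) / (1 / fact ?m)) / real ?m"
    using assms by (intro tendsto_intros tendsto_rstirling tendsto_top_prod) auto
  also have "(1 / 1) * ((1 / fact k) / (1 / fact ?m)) / real ?m = (1::real)"
    by simp
  finally show ?thesis
  proof (rule Lim_transform_eventually)
    show "eventually (\<lambda>n. (?t k n / ?t ?m n) * (?s k n / ?s ?m n) / real ?m =
        rbell_zero r ?m n / (- real ?m * ((real ?m + r - 1) / (real ?m + r)) ^ n)) sequentially"
      using eventually_gt_at_top[of k]
    proof eventually_elim
      case (elim n)
      have pos: "rstirling r n k > 0" "rstirling r n ?m > 0" "top_prod r k n > 0" "top_prod r ?m n > 0"
        using elim assms by (auto intro!: rstirling_pos top_prod_bounds(1))
      have z: "rbell_zero r ?m n = - (top_prod r k n / top_prod r ?m n)"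
        using top_prod_Suc[OF assms elim] pos by (auto simp: field_simps)
      have b: "real ?m + r - 1 = real k + r" "real k + r > 0" "real ?m + r > 0" using assms by auto
      show ?case
        unfolding z b(1) mult_minus_left minus_divide_divide
        using pos b(2,3) assms by (simp add: power_divide)
    qed
  qed
qed

theorem theorem3p1:
  fixes r :: real
  assumes "r > 0"
  shows "(\<forall>n\<ge>1. card {x. poly (rbell r n) x = 0} = n \<and>
            (\<forall>x. poly (rbell r n) x = 0 \<longrightarrow> x < 0 \<and> order x (rbell r n) = 1)) \<and>
         (\<forall>m\<ge>1. (\<lambda>n. rbell_zero r m n /
                    (- real m * ((real m + r - 1) / (real m + r)) ^ n)) \<longlonglongrightarrow> 1)"
proof (intro conjI allI impI)
  show "card {x. poly (rbell r n) x = 0} = n" for n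
    by (rule card_rbell_roots[OF assms])
  show "x < 0" "order x (rbell r n) = 1" if "poly (rbell r n) x = 0" for n x
    using that order_eq_1_of_card_roots[OF rbell_neq_0] rbell_root_neg[OF assms]
    by (auto simp: degree_rbell card_rbell_roots[OF assms])
  show "(\<lambda>n. rbell_zero r m n /
                    (- real m * ((real m + r - 1) / (real m + r)) ^ n)) \<longlonglongrightarrow> 1" if "m \<ge> 1" for m
    using tendsto_rbell_zero[OF assms, of "m - 1"] that by simp
qed

end
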